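(* Let $0\le\alpha<\frac{\pi}{2}$ and let $A,B\in\mathcal{S}_\alpha$ be $n\times n$ complex matrices. Then $$w(AB)\le\sec^2\alpha\;w(A)\,w(B).$$
   Context: $\mathcal{M}_n$ is the algebra of complex $n\times n$ matrices. For $A\in\mathcal{M}_n$: $w(A)=\max\{|\langle Ax,x\rangle|:x\in\mathbb{C}^n,\|x\|=1\}$ is the numerical radius and $W(A)=\{\langle Ax,x\rangle:x\in\mathbb{C}^n,\|x\|=1\}$ is the numerical range. For $0\le\alpha<\pi/2$ let $S_\alpha=\{z\in\mathbb{C}:|\Im z|\le\tan\alpha\,\Re z\}$; we write $A\in\mathcal{S}_\alpha$ if $W(A)\subset S_\alpha$. *)

theory Defs
  imports "HOL-Analysis.Analysis"
begin

text \<open>The library's \<open>\<bullet>\<close> on \<open>complex ^ 'n\<close> is the real inner product, i.e. the real part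
  of the Hermitian one below; both induce the Euclidean \<open>norm\<close>.\<close>

definition hinner :: "complex ^ 'n \<Rightarrow> complex ^ 'n \<Rightarrow> complex" where
  "hinner x y = (\<Sum>i\<in>UNIV. x $ i * cnj (y $ i))"

lemma hinner_self: "hinner x x = of_real ((norm x)\<^sup>2)"
  by (simp add: hinner_def norm_vec_def L2_set_def sum_nonneg flip: complex_norm_square)

definition numerical_range :: "complex ^ 'n ^ 'n \<Rightarrow> complex set" where
  "numerical_range A = {hinner (A *v x) x | x. norm x = 1}"

text \<open>The supremum is a maximum, see \<open>numerical_radius_attained\<close>.\<close>

definition numerical_radius :: "complex ^ 'n ^ 'n \<Rightarrow> real" where
  "numerical_radius A = Sup {cmod (hinner (A *v x) x) | x. norm x = 1}"

text \<open>For \<open>0 < \<alpha> < pi / 2\<close> the condition forces \<open>0 \<le> Re z\<close>; in the degenerate case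
  \<open>\<alpha> = 0\<close> the set is the whole real line.\<close>

definition sector :: "real \<Rightarrow> complex set" where
  "sector \<alpha> = {z. \<bar>Im z\<bar> \<le> tan \<alpha> * Re z}"

definition sectorial :: "real \<Rightarrow> (complex ^ 'n ^ 'n) set" where
  "sectorial \<alpha> = {A. numerical_range A \<subseteq> sector \<alpha>}"

lemma numerical_radius_attained:
  fixes A :: "complex ^ 'n ^ 'n"
  obtains x where "norm x = 1" "numerical_radius A = cmod (hinner (A *v x) x)"
    "\<And>y. norm y = 1 \<Longrightarrow> cmod (hinner (A *v y) y) \<le> numerical_radius A"
proof -
  let ?S = "sphere (0 :: complex ^ 'n) 1" and ?f = "\<lambda>x. cmod (hinner (A *v x) x)"
  have cont: "continuous_on ?S ?f"
    unfolding hinner_def matrix_vector_mult_def by (auto intro!: continuous_intros)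
  obtain u :: "complex ^ 'n" where "u \<in> ?S"
    using vector_choose_size[of 1] by (metis mem_sphere_0 zero_le_one)
  then obtain x where x: "x \<in> ?S" "\<And>y. y \<in> ?S \<Longrightarrow> ?f y \<le> ?f x"
    using continuous_attains_sup[OF compact_sphere _ cont] \<open>u \<in> ?S\<close> by blast
  have "numerical_radius A = ?f x"
    unfolding numerical_radius_def using x by (intro cSup_eq_maximum) auto
  with x show thesis by (intro that[of x]) auto
qed

end

theory Submission
  imports Defs
begin

text \<open>It suffices to show \<open>|\<langle>Ax,y\<rangle>| \<le> sec \<alpha> w(A) \<parallel>x\<parallel> \<parallel>y\<parallel>\<close>, since this can be used for \<open>A\<close> at
  the pair \<open>(Bx, x)\<close> and for \<open>B\<close> at the pair \<open>(x, Bx)\<close>. Write \<open>A = H + iK\<close> with Hermitian \<open>H\<close>, \<open>K\<close>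
  and \<open>t = tan \<alpha>\<close>. For \<open>\<alpha> > 0\<close>, sectoriality says that \<open>P = tH + K\<close> and \<open>Q = tH - K\<close> are positive
  semidefinite, hence \<open>2|\<langle>Px,y\<rangle>| \<le> \<langle>Px,x\<rangle> + \<langle>Py,y\<rangle>\<close> and likewise for \<open>Q\<close>. Since \<open>A\<close> is a
  combination of \<open>P\<close> and \<open>Q\<close> with coefficients of modulus \<open>1 / (2 sin \<alpha>)\<close>, and \<open>P + Q = 2tH\<close>,
  the bound follows. For \<open>\<alpha> = 0\<close> the matrix \<open>A\<close> is merely Hermitian, and the same argument
  works with \<open>P = w(A) + A\<close> and \<open>Q = w(A) - A\<close>.\<close>

text \<open>Working with forms lets scalar multiples and sums of \<open>hinner (A *v x) y\<close>
  and \<open>hinner x y\<close> be handled without building adjoints or the matrices H, K, P,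
  Q.\<close>

definition sesquilinear :: "(complex ^ 'n \<Rightarrow> complex ^ 'n \<Rightarrow> complex) \<Rightarrow> bool" where
  "sesquilinear f \<longleftrightarrow>
     (\<forall>x y z. f (x + y) z = f x z + f y z) \<and> (\<forall>x y z. f x (y + z) = f x y + f x z) \<and>
     (\<forall>c x y. f (c *s x) y = c * f x y) \<and> (\<forall>c x y. f x (c *s y) = cnj c * f x y)"

lemma sesquilinear_hinner: "sesquilinear hinner"
  unfolding sesquilinear_def hinner_def
  by (simp add: algebra_simps sum.distrib sum_distrib_left)

lemma sesquilinear_matrix:
  fixes A :: "complex ^ 'n ^ 'n"
  shows "sesquilinear (\<lambda>x y. hinner (A *v x) y)"
  using sesquilinear_hinner
  unfolding sesquilinear_def matrix_vector_right_distrib vector_scalar_commute by blast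

lemma sesquilinear_add:
  "sesquilinear f \<Longrightarrow> sesquilinear g \<Longrightarrow> sesquilinear (\<lambda>x y. f x y + g x y)"
  by (simp add: sesquilinear_def algebra_simps)

lemma sesquilinear_mult: "sesquilinear f \<Longrightarrow> sesquilinear (\<lambda>x y. c * f x y)"
  by (simp add: sesquilinear_def algebra_simps)

lemma sesquilinear_scaleR:
  assumes "sesquilinear f"
  shows "f (r *\<^sub>R x) (s *\<^sub>R y) = of_real (r * s) * f x y"
proof -
  have scaleR: "r *\<^sub>R v = complex_of_real r *s v" for r and v :: "complex ^ 'n"
    unfolding vec_eq_iff vector_scaleR_component vector_smult_component
    by (simp add: scaleR_conv_of_real)
  show ?thesis
    using assms unfolding sesquilinear_def scaleR by simp
qed

text \<open>Positivity at x - u y, with u a unimodular phase. As f need not be Hermitian,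
  \<open>f x y + cnj (f y x)\<close> stands for twice its Hermitian part.\<close>

lemma accretive_form_bound:
  assumes f: "sesquilinear f" and pos: "\<And>z. 0 \<le> Re (f z z)"
  shows "cmod (f x y + cnj (f y x)) \<le> Re (f x x) + Re (f y y)"
proof -
  define p where "p = f x y + cnj (f y x)"
  \<comment> \<open>u is the phase of p, with 1 as the choice when p = 0.\<close>
  obtain u where u: "cmod u = 1" "cnj u * p = of_real (cmod p)"
  proof (cases "p = 0")
    case True
    then show thesis by (intro that[of 1]) auto
  next
    case False
    have "p * cnj p = of_real (cmod p * cmod p)"
      by (simp flip: complex_norm_square power2_eq_square)
    then have "cnj (p / of_real (cmod p)) * p = of_real (cmod p)"
      using False by (simp add: field_simps)
    then show thesis
      using False by (intro that[of "p / of_real (cmod p)"]) (simp_all add: norm_divide)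
  qed
  have uu: "u * cnj u = 1"
    using u(1) by (simp flip: complex_norm_square)
  have "f (x + (- u) *s y) (x + (- u) *s y)
      = f x x - cnj u * f x y - u * f y x + (u * cnj u) * f y y"
    using f unfolding sesquilinear_def by (simp only:) (simp add: algebra_simps)
  then have "0 \<le> Re (f x x - cnj u * f x y - u * f y x + f y y)"
    using pos[of "x + (- u) *s y"] uu by simp
  also have "\<dots> = Re (f x x) + Re (f y y) - Re (cnj u * p)"
    by (simp add: p_def algebra_simps)
  finally show ?thesis
    unfolding u(2) by (simp add: p_def)
qed

lemma hinner_normalize:
  fixes A :: "complex ^ 'n ^ 'n"
  shows "hinner (A *v x) y
     = of_real (norm x * norm y) * hinner (A *v (x /\<^sub>R norm x)) (y /\<^sub>R norm y)"
proof -
  \<comment> \<open>Also true at v = 0, where \<open>inverse 0 = 0\<close> makes both sides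
    zero.\<close>
  have "norm v *\<^sub>R (v /\<^sub>R norm v) = v" for v :: "complex ^ 'n"
    by (cases "v = 0") auto
  then show ?thesis
    using sesquilinear_scaleR[OF sesquilinear_matrix,
        of A "norm x" "x /\<^sub>R norm x" "norm y" "y /\<^sub>R norm y"] by simp
qed

lemma numerical_radius_ge:
  "norm x = 1 \<Longrightarrow> cmod (hinner (A *v x) x) \<le> numerical_radius A"
  by (rule numerical_radius_attained[of A]) blast

lemma cmod_hinner_le_numerical_radius:
  fixes A :: "complex ^ 'n ^ 'n"
  shows "cmod (hinner (A *v x) x) \<le> numerical_radius A * (norm x)\<^sup>2"
proof (cases "x = 0")
  case True
  then show ?thesis by (simp add: hinner_def)
next
  case False
  have "cmod (hinner (A *v (x /\<^sub>R norm x)) (x /\<^sub>R norm x)) \<le> numerical_radius A"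
    using False by (intro numerical_radius_ge) simp
  then show ?thesis
    by (subst hinner_normalize)
      (simp add: norm_mult power2_eq_square mult_left_mono mult.commute[of "numerical_radius A"])
qed

lemma sectorial_form:
  fixes A :: "complex ^ 'n ^ 'n"
  assumes "A \<in> sectorial \<alpha>"
  shows "\<bar>Im (hinner (A *v x) x)\<bar> \<le> tan \<alpha> * Re (hinner (A *v x) x)"
proof (cases "x = 0")
  case True
  then show ?thesis by (simp add: hinner_def)
next
  case False
  define e where "e = hinner (A *v (x /\<^sub>R norm x)) (x /\<^sub>R norm x)"
  have "norm (x /\<^sub>R norm x) = 1"
    using False by simp
  then have "e \<in> numerical_range A"
    unfolding numerical_range_def e_def by blast
  then have "e \<in> sector \<alpha>"
    using assms unfolding sectorial_def by blast
  moreover have "hinner (A *v x) x = of_real ((norm x)\<^sup>2) * e"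
    using hinner_normalize[of A x x] by (simp add: e_def power2_eq_square)
  ultimately show ?thesis
    using mult_left_mono[of "\<bar>Im e\<bar>" "tan \<alpha> * Re e" "(norm x)\<^sup>2"]
    by (simp add: sector_def abs_mult algebra_simps)
qed

lemma hermitian_bound_unit:
  fixes A :: "complex ^ 'n ^ 'n"
  assumes real: "\<And>z. Im (hinner (A *v z) z) = 0" and "norm x = 1" "norm y = 1"
  shows "cmod (hinner (A *v x) y) \<le> numerical_radius A"
proof -
  let ?a = "\<lambda>x y. hinner (A *v x) y" and ?w = "numerical_radius A"
  let ?f = "\<lambda>s x y. of_real ?w * hinner x y + s * ?a x y"
  have f: "sesquilinear (?f s)" for s
    by (intro sesquilinear_add sesquilinear_mult sesquilinear_hinner sesquilinear_matrix)
  have le: "Re (?a z z) \<le> ?w * (norm z)\<^sup>2" "0 \<le> ?w * (norm z)\<^sup>2 + Re (?a z z)" for z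
    using cmod_hinner_le_numerical_radius[of A z] abs_Re_le_cmod[of "?a z z"] by linarith+
  \<comment> \<open>The form \<open>\<i> * ?a\<close> has zero real part on the diagonal, so the
    bound forces its Hermitian part to vanish.\<close>
  have "cmod (\<i> * ?a x y + cnj (\<i> * ?a y x)) \<le> Re (\<i> * ?a x x) + Re (\<i> * ?a y y)"
    using real by (intro accretive_form_bound sesquilinear_mult sesquilinear_matrix) simp
  then have herm: "cnj (?a y x) = ?a x y"
    using real by (simp add: complex_eq_iff)
  have P: "cmod (?f 1 x y + cnj (?f 1 y x)) \<le> Re (?f 1 x x) + Re (?f 1 y y)"
    by (intro accretive_form_bound[OF f]) (simp add: hinner_self le)
  have Q: "cmod (?f (-1) x y + cnj (?f (-1) y x)) \<le> Re (?f (-1) x x) + Re (?f (-1) y y)"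
    by (intro accretive_form_bound[OF f]) (simp add: hinner_self le)
  have "4 * ?a x y = (?f 1 x y + cnj (?f 1 y x)) - (?f (-1) x y + cnj (?f (-1) y x))"
    by (simp add: herm)
  then have "4 * cmod (?a x y)
      \<le> cmod (?f 1 x y + cnj (?f 1 y x)) + cmod (?f (-1) x y + cnj (?f (-1) y x))"
    using norm_triangle_ineq4 by (metis (no_types) norm_mult norm_numeral)
  also have "\<dots> \<le> 4 * ?w"
    using add_mono[OF P Q] assms by (simp add: hinner_self)
  finally show ?thesis by simp
qed

lemma sectorial_bound_unit:
  fixes A :: "complex ^ 'n ^ 'n"
  assumes "0 < \<alpha>" "\<alpha> < pi / 2" "A \<in> sectorial \<alpha>" "norm x = 1" "norm y = 1"
  shows "cmod (hinner (A *v x) y) \<le> 1 / cos \<alpha> * numerical_radius A"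
proof -
  let ?a = "\<lambda>x y. hinner (A *v x) y"
  \<comment> \<open>\<open>Re (c * ?a z z)\<close> is the quadratic form of P = tH + K, and
    \<open>cnj c\<close> gives Q = tH - K; thus \<open>?p c\<close> is
    2\<langle>Px,y\<rangle>.\<close>
  define c where "c = Complex (tan \<alpha>) (- 1)"
  let ?p = "\<lambda>c. c * ?a x y + cnj (c * ?a y x)"
  have t: "tan \<alpha> > 0" and cos: "cos \<alpha> > 0"
    using assms by (auto intro: tan_gt_zero cos_gt_zero_pi)
  have "(tan \<alpha>)\<^sup>2 + 1 = (1 / cos \<alpha>)\<^sup>2"
    using tan_sec[of \<alpha>] cos by (simp add: inverse_eq_divide power_one_over)
  then have c: "cmod c = 1 / cos \<alpha>"
    using cos by (simp add: c_def cmod_def real_sqrt_unique)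
  have sect: "Im (?a z z) \<le> tan \<alpha> * Re (?a z z)" "0 \<le> tan \<alpha> * Re (?a z z) + Im (?a z z)" for z
    using sectorial_form[OF assms(3), of z] by auto
  have P: "cmod (?p c) \<le> Re (c * ?a x x) + Re (c * ?a y y)"
    by (intro accretive_form_bound sesquilinear_mult sesquilinear_matrix)
      (simp add: c_def sect)
  have Q: "cmod (?p (cnj c)) \<le> Re (cnj c * ?a x x) + Re (cnj c * ?a y y)"
    by (intro accretive_form_bound sesquilinear_mult sesquilinear_matrix)
      (simp add: c_def sect)
  have Re: "Re (?a z z) \<le> numerical_radius A" if "norm z = 1" for z
    using cmod_hinner_le_numerical_radius[of A z] complex_Re_le_cmod[of "?a z z"] that by simp
  \<comment> \<open>The \<open>cnj (?a y x)\<close> terms both carry |c|^2 and cancel, leaving c^2 -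
    (cnj c)^2 = -4i tan \<alpha> as coefficient of \<open>?a x y\<close>.\<close>
  have "of_real (4 * tan \<alpha>) * (- \<i> * ?a x y) = c * ?p c - cnj c * ?p (cnj c)"
    by (simp add: c_def complex_eq_iff algebra_simps)
  then have "cmod (of_real (4 * tan \<alpha>) * (- \<i> * ?a x y))
      \<le> cmod c * cmod (?p c) + cmod c * cmod (?p (cnj c))"
    using norm_triangle_ineq4[of "c * ?p c" "cnj c * ?p (cnj c)"]
    by (simp only: norm_mult complex_mod_cnj)
  also have "cmod (of_real (4 * tan \<alpha>) * (- \<i> * ?a x y)) = 4 * tan \<alpha> * cmod (?a x y)"
    using t by (simp add: norm_mult)
  \<comment> \<open>Since c + cnj c = 2 tan \<alpha>, the imaginary parts of the diagonal values
    cancel.\<close>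
  also have "cmod c * cmod (?p c) + cmod c * cmod (?p (cnj c))
      \<le> cmod c * (2 * tan \<alpha> * (Re (?a x x) + Re (?a y y)))"
    using mult_left_mono[OF add_mono[OF P Q], of "cmod c"] by (simp add: c_def algebra_simps)
  also have "\<dots> \<le> cmod c * (2 * tan \<alpha> * (numerical_radius A + numerical_radius A))"
    using t assms by (intro mult_left_mono add_mono Re) auto
  finally have "4 * tan \<alpha> * cmod (?a x y) \<le> 4 * tan \<alpha> * (cmod c * numerical_radius A)"
    by (simp add: mult_ac)
  with t have "cmod (?a x y) \<le> cmod c * numerical_radius A"
    by simp
  then show ?thesis
    by (simp add: c)
qed

lemma sectorial_bound:
  fixes A :: "complex ^ 'n ^ 'n"
  assumes "0 \<le> \<alpha>" "\<alpha> < pi / 2" "A \<in> sectorial \<alpha>"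
  shows "cmod (hinner (A *v x) y) \<le> 1 / cos \<alpha> * numerical_radius A * (norm x * norm y)"
proof (cases "x = 0 \<or> y = 0")
  case True
  then show ?thesis by (auto simp: hinner_def)
next
  case False
  have unit: "cmod (hinner (A *v u) v) \<le> 1 / cos \<alpha> * numerical_radius A"
    if "norm u = 1" "norm v = 1" for u v
  \<comment> \<open>The sector argument divides by tan \<alpha>; at \<alpha> = 0 the form is real on
    the diagonal and cos \<alpha> = 1.\<close>
  proof (cases "\<alpha> = 0")
    case True
    have "Im (hinner (A *v z) z) = 0" for z
      using sectorial_form[OF assms(3), of z] True by simp
    then show ?thesis
      using hermitian_bound_unit that True by auto
  next
    case False
    then show ?thesis
      using sectorial_bound_unit[of \<alpha>] assms that by fastforce
  qed
  have "cmod (hinner (A *v x) y)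
      = norm x * norm y * cmod (hinner (A *v (x /\<^sub>R norm x)) (y /\<^sub>R norm y))"
    by (subst hinner_normalize) (simp add: norm_mult)
  also have "\<dots> \<le> norm x * norm y * (1 / cos \<alpha> * numerical_radius A)"
    using False by (intro mult_left_mono unit) auto
  finally show ?thesis by (simp add: mult_ac)
qed

theorem theorem3p3:
  fixes \<alpha> :: real and A B :: "complex ^ 'n ^ 'n"
  assumes "0 \<le> \<alpha>" and "\<alpha> < pi / 2"
    and "A \<in> sectorial \<alpha>" and "B \<in> sectorial \<alpha>"
  shows "numerical_radius (A ** B)
           \<le> (1 / cos \<alpha>)\<^sup>2 * numerical_radius A * numerical_radius B"
proof -
  obtain x where x: "norm x = 1"
      "numerical_radius (A ** B) = cmod (hinner ((A ** B) *v x) x)"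
    using numerical_radius_attained by blast
  let ?y = "B *v x"
  have nonneg: "0 \<le> 1 / cos \<alpha> * numerical_radius A"
    using order_trans[OF norm_ge_zero sectorial_bound[OF assms(1-3), of x x]] x(1) by simp
  have "(norm ?y)\<^sup>2 \<le> 1 / cos \<alpha> * numerical_radius B * norm ?y"
    using sectorial_bound[OF assms(1,2,4), of x ?y] x(1)
    by (simp only: hinner_self norm_of_real)
  \<comment> \<open>Covers Bx = 0, where a factor \<open>norm ?y\<close> cannot be
    cancelled.\<close>
  moreover have "0 \<le> 1 / cos \<alpha> * numerical_radius B"
    using order_trans[OF norm_ge_zero sectorial_bound[OF assms(1,2,4), of x x]] x(1) by simp
  ultimately have B: "norm ?y \<le> 1 / cos \<alpha> * numerical_radius B"
    by (cases "?y = 0") (simp, simp only: power2_eq_square mult_le_cancel_right, simp)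
  have "numerical_radius (A ** B) \<le> 1 / cos \<alpha> * numerical_radius A * norm ?y"
    using sectorial_bound[OF assms(1-3), of ?y x] x
    by (simp add: matrix_vector_mul_assoc[symmetric])
  also have "\<dots> \<le> 1 / cos \<alpha> * numerical_radius A * (1 / cos \<alpha> * numerical_radius B)"
    using B nonneg by (rule mult_left_mono)
  finally show ?thesis
    by (simp add: power2_eq_square mult_ac)
qed

end
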